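(* Let $\Gamma=[\gamma_{ij}]\in\mathbb{R}^{p\times p}$ be a connected continuous-time interconnection and let $Q:\mathbb{R}_{\ge0}\to\overline{\mathcal Q}_n$ be Riemann-integrable and persistently exciting. Then the solutions $x_i(\cdot)$ of $\dot x_i=Q_t\sum_{j\ne i}\gamma_{ij}(x_j-x_i)$, $i=1,\dots,p$, exponentially synchronize to $\bar x(t)\equiv(r^T\otimes I_n)\mathbf x(0)$, where $\mathbf x=[x_1^T\cdots x_p^T]^T$ and $r^T\Gamma=0$, $r^T\mathbf 1=1$.
   Context: $|\cdot|$ induced 2-norm; $\mathbf 1$ all-ones vector; $\otimes$ Kronecker product; $\sigma_{\min}$ smallest singular value; $\overline{\mathcal Q}_n$ the set of symmetric positive semidefinite $n\times n$ matrices $R$ with $|R|\le1$. $Q$ is persistently exciting if there exist $\varepsilon,T>0$ with $\sigma_{\min}\big(\int_t^{t+T}Q_\tau d\tau\big)\ge\varepsilon$ for all $t\ge0$. Continuous-time interconnection: $\gamma_{ij}\ge0$ ($i\ne j$), $\gamma_{ii}=-\sum_{j\ne i}\gamma_{ij}$; graph edge $(n_i,n_j)$ iff $\gamma_{ij}>0$; connected if some node is reachable by a directed path from every other node. Exponential synchronization to $\bar x$: there are $c,\alpha>0$ with $\max_i|x_i(t)-\bar x(t)|\le ce^{-\alpha t}$ for all $t\ge0$. *)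

theory Defs
  imports "HOL-Analysis.Analysis"
begin

text \<open>Riemann integrability on a compact interval: Riemann sums over tagged
divisions that are fine w.r.t. a constant gauge converge.\<close>
definition riemann_integrable_on :: "(real \<Rightarrow> 'a::real_normed_vector) \<Rightarrow> real \<Rightarrow> real \<Rightarrow> bool" where
  "riemann_integrable_on f a b \<longleftrightarrow>
     (\<exists>I. \<forall>e>0. \<exists>d>0. \<forall>D. D tagged_division_of {a..b} \<and> (\<lambda>x. ball x d) fine D \<longrightarrow>
        norm ((\<Sum>(x,K)\<in>D. Henstock_Kurzweil_Integration.content K *\<^sub>R f x) - I) < e)"

text \<open>Riemann integrable on the half line: on every compact subinterval.\<close>
definition riemann_integrable_halfline :: "(real \<Rightarrow> 'a::real_normed_vector) \<Rightarrow> bool" where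
  "riemann_integrable_halfline f \<longleftrightarrow> (\<forall>a b. 0 \<le> a \<longrightarrow> a \<le> b \<longrightarrow> riemann_integrable_on f a b)"

text \<open>Smallest singular value of a square matrix.\<close>
definition sigma_min :: "real^'n^'n \<Rightarrow> real" where
  "sigma_min A = Inf {norm (A *v v) | v. norm v = 1}"

text \<open>Induced 2-norm of a matrix.\<close>
definition mat_norm2 :: "real^'n^'m \<Rightarrow> real" where
  "mat_norm2 A = onorm (\<lambda>v. A *v v)"

text \<open>The set \<open>Q_n bar\<close>: symmetric PSD matrices with induced 2-norm at most 1.\<close>
definition Qbar :: "(real^'n^'n) set" where
  "Qbar = {R. transpose R = R \<and> (\<forall>v. v \<bullet> (R *v v) \<ge> 0) \<and> mat_norm2 R \<le> 1}"

definition persistently_exciting :: "(real \<Rightarrow> real^'n^'n) \<Rightarrow> bool" where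
  "persistently_exciting Q \<longleftrightarrow>
     (\<exists>\<epsilon> T. \<epsilon> > 0 \<and> T > 0 \<and> (\<forall>t\<ge>0. sigma_min (integral {t..t+T} Q) \<ge> \<epsilon>))"

definition ct_interconnection :: "real^'p^'p \<Rightarrow> bool" where
  "ct_interconnection G \<longleftrightarrow>
     (\<forall>i j. i \<noteq> j \<longrightarrow> G$i$j \<ge> 0) \<and> (\<forall>i. G$i$i = - (\<Sum>j\<in>UNIV-{i}. G$i$j))"

definition graph_edges :: "real^'p^'p \<Rightarrow> ('p \<times> 'p) set" where
  "graph_edges G = {(i,j). G$i$j > 0}"

text \<open>Connected: some node is reachable by a directed path from every other node.\<close>
definition graph_connected :: "real^'p^'p \<Rightarrow> bool" where
  "graph_connected G \<longleftrightarrow> (\<exists>k. \<forall>i. (i,k) \<in> (graph_edges G)\<^sup>*)"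

end

theory Submission
  imports Defs
begin

text \<open>
  For small \<open>h > 0\<close> the matrix \<open>A = I + h\<Gamma>\<close> is row stochastic with positive diagonal, and connectedness
  gives some power of \<open>A\<close> a positive column; hence the columns of \<open>A\<^sup>n\<close> become constant and
  \<open>A\<^sup>n \<rightarrow> 1 r\<^sup>T\<close>. The errors \<open>e\<^sub>i = x\<^sub>i - \<Sum>\<^sub>j r\<^sub>j x\<^sub>j(0)\<close> satisfy \<open>e' = (\<Gamma> \<otimes> Q\<^sub>t) e\<close> and \<open>r\<^sup>T e = 0\<close>, and for
  large \<open>N\<close> the function \<open>V = \<Sum>\<^sub>n\<^sub><\<^sub>N \<parallel>A\<^sup>n e\<parallel>\<^sup>2\<close> satisfies \<open>V' \<le> - (1/2h) \<Sum>\<^sub>i e\<^sub>i\<^sup>T Q\<^sub>t e\<^sub>i\<close>. Over a window of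
  persistent excitation, the integral of the right-hand side is at least a fixed fraction of \<open>\<parallel>e\<parallel>\<^sup>2\<close>
  at its start, so \<open>V\<close> contracts by a fixed factor per window.
\<close>

section \<open>Positive semidefinite matrices\<close>

lemma matrix_vector_mult_sum_right:
  fixes R :: "real^'n^'m"
  shows "R *v sum f S = (\<Sum>i\<in>S. R *v f i)"
  by (rule linear_sum) simp

lemma symmetric_inner_matrix_vector:
  fixes R :: "real^'n^'n"
  assumes "transpose R = R"
  shows "v \<bullet> (R *v w) = w \<bullet> (R *v v)"
  by (metis assms dot_lmul_matrix inner_commute vector_transpose_matrix)

text \<open>Evaluate the nonnegative form at \<open>v - (1/c) *\<^sub>R (R *v v)\<close> and bound
  the form at \<open>R *v v\<close> by \<open>c\<close> times its squared norm; no eigenvalues or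
  square roots of \<open>R\<close> are needed. It serves twice: with \<open>c = 1\<close> for the
  values of \<open>Q\<close>, and with \<open>c\<close> the window length for the excitation
  integral.\<close>

lemma psd_norm_image_squared_le:
  fixes R :: "real^'n^'n"
  assumes sym: "transpose R = R" and psd: "\<And>v. v \<bullet> (R *v v) \<ge> 0"
    and c: "c > 0" "\<And>v. norm (R *v v) \<le> c * norm v"
  shows "(norm (R *v v))\<^sup>2 \<le> c * (v \<bullet> (R *v v))"
proof -
  let ?w = "R *v v"
  have eq: "(v - (1/c) *\<^sub>R ?w) \<bullet> (R *v (v - (1/c) *\<^sub>R ?w))
      = v \<bullet> ?w - 2/c * (norm ?w)\<^sup>2 + 1/c^2 * (?w \<bullet> (R *v ?w))"
    using symmetric_inner_matrix_vector[OF sym, of v ?w]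
    by (simp add: matrix_vector_mult_diff_distrib matrix_vector_mult_scaleR inner_diff_left
        inner_diff_right power2_norm_eq_inner)
      (simp add: diff_divide_distrib power2_eq_square)
  have "?w \<bullet> (R *v ?w) \<le> norm ?w * (c * norm ?w)"
    by (meson c(2) mult_left_mono norm_cauchy_schwarz norm_ge_zero order_trans)
  then have "1/c^2 * (?w \<bullet> (R *v ?w)) \<le> 1/c^2 * (norm ?w * (c * norm ?w))"
    using c(1) by (intro mult_left_mono) auto
  also have "\<dots> = 1/c * (norm ?w)\<^sup>2"
    using c(1) by (simp add: power2_eq_square)
  finally have "0 \<le> v \<bullet> ?w - 2/c * (norm ?w)\<^sup>2 + 1/c * (norm ?w)\<^sup>2"
    using psd[of "v - (1/c) *\<^sub>R ?w"] eq by linarith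
  then have "1/c * (norm ?w)\<^sup>2 \<le> v \<bullet> ?w"
    by (simp add: field_simps)
  then show ?thesis using c(1) by (simp add: field_simps)
qed

lemma psd_two_inner_le:
  fixes R :: "real^'n^'n"
  assumes sym: "transpose R = R" and psd: "\<And>v. v \<bullet> (R *v v) \<ge> 0"
  shows "2 * (v \<bullet> (R *v w)) \<le> v \<bullet> (R *v v) + w \<bullet> (R *v w)"
  using psd[of "v - w"] symmetric_inner_matrix_vector[OF sym, of v w]
  by (simp add: matrix_vector_mult_diff_distrib inner_diff_left inner_diff_right)

text \<open>Each cross term is at most the mean of two diagonal terms; counting them yields the
  Cauchy-Schwarz factor \<open>card S\<close>.\<close>

lemma psd_sum_le:
  fixes R :: "real^'n^'n"
  assumes sym: "transpose R = R" and psd: "\<And>v. v \<bullet> (R *v v) \<ge> 0"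
  shows "(\<Sum>i\<in>S. f i) \<bullet> (R *v (\<Sum>i\<in>S. f i)) \<le> real (card S) * (\<Sum>i\<in>S. f i \<bullet> (R *v f i))"
proof -
  let ?q = "\<lambda>i. f i \<bullet> (R *v f i)"
  have "(\<Sum>i\<in>S. f i) \<bullet> (R *v (\<Sum>i\<in>S. f i)) = (\<Sum>i\<in>S. \<Sum>j\<in>S. f i \<bullet> (R *v f j))"
    by (simp only: matrix_vector_mult_sum_right inner_sum_left inner_sum_right) (rule sum.swap)
  also have "\<dots> \<le> (\<Sum>i\<in>S. \<Sum>j\<in>S. (?q i + ?q j) / 2)"
  proof (intro sum_mono)
    fix i j
    show "f i \<bullet> (R *v f j) \<le> (?q i + ?q j) / 2"
      using psd_two_inner_le[OF sym psd, of "f i" "f j"] by simp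
  qed
  also have "\<dots> = real (card S) * (\<Sum>i\<in>S. ?q i)"
    by (simp add: add_divide_distrib sum.distrib sum_divide_distrib[symmetric]
        sum_distrib_left[symmetric])
  finally show ?thesis .
qed

lemma psd_add_le:
  fixes R :: "real^'n^'n"
  assumes sym: "transpose R = R" and psd: "\<And>v. v \<bullet> (R *v v) \<ge> 0"
  shows "(v + w) \<bullet> (R *v (v + w)) \<le> 2 * (v \<bullet> (R *v v)) + 2 * (w \<bullet> (R *v w))"
  using psd_two_inner_le[OF sym psd, of v w] symmetric_inner_matrix_vector[OF sym, of v w]
  by (simp add: matrix_vector_right_distrib inner_add_left inner_add_right)

lemma
  assumes "R \<in> Qbar"
  shows Qbar_transpose: "transpose R = R"
    and Qbar_nonneg: "v \<bullet> (R *v v) \<ge> 0"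
    and Qbar_norm_le: "norm (R *v v) \<le> norm v"
proof -
  show "transpose R = R" "v \<bullet> (R *v v) \<ge> 0"
    using assms by (auto simp: Qbar_def)
  have "norm (R *v v) \<le> onorm ((*v) R) * norm v"
    by (intro onorm) simp
  also have "\<dots> \<le> 1 * norm v"
    using assms by (intro mult_right_mono) (auto simp: Qbar_def mat_norm2_def)
  finally show "norm (R *v v) \<le> norm v" by simp
qed

lemma Qbar_inner_le:
  assumes "R \<in> Qbar"
  shows "v \<bullet> (R *v v) \<le> (norm v)\<^sup>2"
  by (metis Qbar_norm_le[OF assms] mult_left_mono norm_cauchy_schwarz norm_ge_zero order_trans
      power2_eq_square)

lemma Qbar_norm_squared_le:
  assumes "R \<in> Qbar"
  shows "(norm (R *v v))\<^sup>2 \<le> v \<bullet> (R *v v)"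
  using psd_norm_image_squared_le[OF Qbar_transpose[OF assms] Qbar_nonneg[OF assms], of 1 v]
    Qbar_norm_le[OF assms] by simp

section \<open>Integration\<close>

text \<open>A constant radius \<open>d\<close> is the special gauge
  \<open>\<lambda>x. ball x d\<close> of the Henstock-Kurzweil integral.\<close>

lemma riemann_integrable_on_imp_integrable_on:
  assumes "riemann_integrable_on f a b"
  shows "f integrable_on {a..b}"
proof -
  from assms obtain I where I: "\<And>e. e > 0 \<Longrightarrow> \<exists>d>0. \<forall>D. D tagged_division_of {a..b} \<and> (\<lambda>x. ball x d) fine D \<longrightarrow>
        norm ((\<Sum>(x,K)\<in>D. Henstock_Kurzweil_Integration.content K *\<^sub>R f x) - I) < e"
    unfolding riemann_integrable_on_def by blast
  have "(f has_integral I) (cbox a b)"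
    unfolding has_integral
  proof (intro allI impI)
    fix e :: real assume "e > 0"
    from I[OF this] obtain d where "d > 0" and
      d: "\<forall>D. D tagged_division_of {a..b} \<and> (\<lambda>x. ball x d) fine D \<longrightarrow>
        norm ((\<Sum>(x,K)\<in>D. Henstock_Kurzweil_Integration.content K *\<^sub>R f x) - I) < e" by blast
    with \<open>d > 0\<close> show "\<exists>\<gamma>. gauge \<gamma> \<and> (\<forall>\<D>. \<D> tagged_division_of (cbox a b) \<and> \<gamma> fine \<D> \<longrightarrow>
        norm ((\<Sum>(x, k)\<in>\<D>. Henstock_Kurzweil_Integration.content k *\<^sub>R f x) - I) < e)"
      by (intro exI[of _ "\<lambda>x. ball x d"] conjI) auto
  qed
  then show ?thesis by (auto simp: integrable_on_def)
qed

text \<open>Continuity of \<open>H\<close> keeps the composition measurable, and the constant bound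
  then makes it integrable. The role of \<open>f\<close> is taken by possibly discontinuous data:
  the velocity of a trajectory, or \<open>Q\<close> itself.\<close>

lemma integrable_bounded_compose2:
  fixes f :: "real \<Rightarrow> 'a::euclidean_space" and g :: "real \<Rightarrow> 'b::euclidean_space"
    and H :: "'a \<Rightarrow> 'b \<Rightarrow> 'c::euclidean_space"
  assumes f: "f integrable_on {a..b}" and g: "continuous_on {a..b} g"
    and H: "continuous_on UNIV (\<lambda>z. H (fst z) (snd z))"
    and B: "\<And>s. s \<in> {a..b} \<Longrightarrow> norm (H (f s) (g s)) \<le> B"
  shows "(\<lambda>s. H (f s) (g s)) integrable_on {a..b}"
proof (rule measurable_bounded_by_integrable_imp_integrable)
  have "f \<in> borel_measurable (lebesgue_on {a..b})" "g \<in> borel_measurable (lebesgue_on {a..b})"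
    using integrable_imp_measurable[OF f] continuous_imp_measurable_on_sets_lebesgue[OF g] by auto
  then show "(\<lambda>s. H (f s) (g s)) \<in> borel_measurable (lebesgue_on {a..b})"
    using H by (rule borel_measurable_continuous_Pair)
  show "(\<lambda>s. B) integrable_on {a..b}" by (rule integrable_const_ivl)
qed (use B in auto)

lemma continuous_on_primitive:
  fixes u :: "real \<Rightarrow> 'a::banach"
  assumes "\<And>t. t \<in> {a..b} \<Longrightarrow> (f has_integral (u t - u a)) {a..t}"
  shows "continuous_on {a..b} u"
proof (cases "a \<le> b")
  case True
  then have "f integrable_on {a..b}" using assms[of b] by (auto simp: integrable_on_def)
  then have "continuous_on {a..b} (\<lambda>t. u a + integral {a..t} f)"
    by (intro continuous_intros indefinite_integral_continuous_1)
  moreover have "u a + integral {a..t} f = u t" if "t \<in> {a..b}" for t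
    using integral_unique[OF assms[OF that]] by simp
  ultimately show ?thesis by (rule continuous_on_eq)
qed simp

lemma has_integral_primitive_subinterval:
  fixes u :: "real \<Rightarrow> 'a::banach"
  assumes "\<And>t. t \<in> {a..b} \<Longrightarrow> (f has_integral (u t - u a)) {a..t}" and "a \<le> s" "s \<le> t" "t \<le> b"
  shows "(f has_integral (u t - u s)) {s..t}"
proof -
  have as: "(f has_integral (u s - u a)) {a..s}" and at: "(f has_integral (u t - u a)) {a..t}"
    using assms by auto
  have "f integrable_on {s..t}"
    by (rule integrable_subinterval_real[OF has_integral_integrable[OF at]]) (use assms(2) in auto)
  then have st: "(f has_integral (integral {s..t} f)) {s..t}" by (rule integrable_integral)
  have "u s - u a + integral {s..t} f = u t - u a"
    by (rule has_integral_unique[OF has_integral_combine[OF assms(2,3) as st] at])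
  then have "integral {s..t} f = u t - u s" by (simp add: algebra_simps)
  then show ?thesis using st by simp
qed

text \<open>The difference quotient at \<open>x\<close> is at most
  \<open>C * \<bar>y - x\<bar>\<close> in size, so \<open>F\<close> has derivative zero throughout
  the interval.\<close>

lemma constant_if_quadratic_increments:
  fixes F :: "real \<Rightarrow> real"
  assumes "\<And>s t. \<lbrakk>a \<le> s; s \<le> t; t \<le> b\<rbrakk> \<Longrightarrow> \<bar>F t - F s\<bar> \<le> C * (t - s)\<^sup>2" and "a \<le> b"
  shows "F b = F a"
proof -
  have bound: "norm (F y - F x) \<le> C * (y - x)\<^sup>2" if "x \<in> {a..b}" "y \<in> {a..b}" for x y
    using assms(1)[of x y] assms(1)[of y x] that
    by (cases "x \<le> y") (auto simp: abs_minus_commute power2_commute)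
  have "\<exists>c. \<forall>x\<in>{a..b}. F x = c"
  proof (rule has_field_derivative_zero_constant)
    fix x assume x: "x \<in> {a..b}"
    have "((\<lambda>y. (F y - F x) / (y - x)) \<longlongrightarrow> 0) (at x within {a..b})"
    proof (rule Lim_null_comparison)
      show "\<forall>\<^sub>F y in at x within {a..b}. norm ((F y - F x) / (y - x)) \<le> C * \<bar>y - x\<bar>"
        unfolding eventually_at_filter
      proof (intro always_eventually allI impI)
        fix y assume "y \<noteq> x" "y \<in> {a..b}"
        then show "norm ((F y - F x) / (y - x)) \<le> C * \<bar>y - x\<bar>"
          using bound[OF x, of y] by (simp add: divide_simps power2_eq_square algebra_simps flip: abs_mult)
      qed
      show "((\<lambda>y. C * \<bar>y - x\<bar>) \<longlongrightarrow> 0) (at x within {a..b})"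
        by (auto intro!: tendsto_eq_intros)
    qed
    then show "(F has_field_derivative 0) (at x within {a..b})"
      by (simp add: has_field_derivative_iff)
  qed simp
  then show ?thesis using assms(2) by auto
qed

lemma continuous_on_interval_bounded:
  fixes u :: "real \<Rightarrow> 'a::real_normed_vector"
  assumes "continuous_on {a..b} u"
  obtains U where "\<And>s. s \<in> {a..b} \<Longrightarrow> norm (u s) \<le> U"
proof -
  have "bounded (u ` {a..b})"
    using assms by (intro compact_imp_bounded compact_continuous_image) auto
  then show ?thesis using that unfolding bounded_iff by blast
qed

text \<open>Since \<open>f\<close> need not be continuous, \<open>u\<close> need not be differentiable; but the increments of
  \<open>\<parallel>u\<parallel>\<^sup>2\<close> agree with those of the integral up to a quadratic error.\<close>
lemma has_integral_norm_squared:
  fixes u f :: "real \<Rightarrow> 'a::euclidean_space"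
  assumes prim: "\<And>t. t \<in> {a..b} \<Longrightarrow> (f has_integral (u t - u a)) {a..t}"
    and K: "\<And>s. s \<in> {a..b} \<Longrightarrow> norm (f s) \<le> K" and ab: "a \<le> b"
  shows "((\<lambda>s. 2 * (u s \<bullet> f s)) has_integral ((norm (u b))\<^sup>2 - (norm (u a))\<^sup>2)) {a..b}"
proof -
  have K0: "0 \<le> K" using K[of a] ab order_trans[OF norm_ge_zero] by fastforce
  have sub: "(f has_integral (u t - u s)) {s..t}" if "a \<le> s" "s \<le> t" "t \<le> b" for s t
    using has_integral_primitive_subinterval[OF prim that] .
  have lip: "norm (u t - u s) \<le> K * (t - s)" if "a \<le> s" "s \<le> t" "t \<le> b" for s t
    using has_integral_bound[of K f "u t - u s" s t] sub[OF that] K K0 that by simp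
  have cont: "continuous_on {a..b} u" using prim by (rule continuous_on_primitive)
  obtain U where U: "\<And>s. s \<in> {a..b} \<Longrightarrow> norm (u s) \<le> U"
    using continuous_on_interval_bounded[OF cont] by blast
  have "(\<lambda>s. u s \<bullet> f s) integrable_on {a..b}"
  proof (rule integrable_bounded_compose2[where H = "\<lambda>p q. q \<bullet> p"])
    show "f integrable_on {a..b}" using prim[of b] ab by (auto simp: integrable_on_def)
    show "norm (u s \<bullet> f s) \<le> U * K" if "s \<in> {a..b}" for s
    proof -
      have "norm (u s \<bullet> f s) \<le> norm (u s) * norm (f s)"
        by (simp add: Cauchy_Schwarz_ineq2)
      also have "\<dots> \<le> U * K"
        using U[OF that] K[OF that] by (intro mult_mono) (auto intro: order_trans[OF norm_ge_zero])
      finally show ?thesis .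
    qed
  qed (use cont in \<open>auto intro!: continuous_intros\<close>)
  then have int: "(\<lambda>s. 2 * (u s \<bullet> f s)) integrable_on {a..b}"
    by (rule integrable_on_mult_right)
  let ?I = "\<lambda>t. integral {a..t} (\<lambda>s. 2 * (u s \<bullet> f s))"
  let ?F = "\<lambda>t. (norm (u t))\<^sup>2 - ?I t"
  have "?F b = ?F a"
  proof (rule constant_if_quadratic_increments[where F = ?F and C = "2 * K * K"])
    fix s t assume st: "a \<le> s" "s \<le> t" "t \<le> b"
    have i1: "(\<lambda>s. 2 * (u s \<bullet> f s)) integrable_on {s..t}"
      by (rule integrable_subinterval_real[OF int]) (use st in auto)
    have "(\<lambda>s. 2 * (u s \<bullet> f s)) integrable_on {a..t}"
      by (rule integrable_subinterval_real[OF int]) (use st in auto)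
    from Henstock_Kurzweil_Integration.integral_combine[OF st(1,2) this]
    have "?I t = ?I s + integral {s..t} (\<lambda>s. 2 * (u s \<bullet> f s))"
      by (rule sym)
    then have Feq: "?F t - ?F s = (norm (u t))\<^sup>2 - (norm (u s))\<^sup>2 - integral {s..t} (\<lambda>s. 2 * (u s \<bullet> f s))"
      by simp
    \<comment> \<open>The inner product of \<open>u t + u s\<close> and \<open>u t - u s\<close> is
      the difference of the squared norms. What remains in the increment of \<open>?F\<close> is the
      deviation of \<open>2 *\<^sub>R u r\<close> from \<open>u t + u s\<close>, of order
      \<open>t - s\<close> by the Lipschitz bound, integrated over a length
      \<open>t - s\<close>.\<close>
    have "((\<lambda>r. (u t + u s) \<bullet> f r) has_integral ((u t + u s) \<bullet> (u t - u s))) {s..t}"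
      using has_integral_linear[OF sub[OF st] bounded_linear_inner_right] by (simp add: o_def)
    from has_integral_diff[OF this integrable_integral[OF i1]]
    have h: "((\<lambda>r. (u t + u s - 2 *\<^sub>R u r) \<bullet> f r) has_integral (?F t - ?F s)) {s..t}"
      unfolding Feq
      by (simp add: inner_diff_left inner_add_left inner_diff_right power2_norm_eq_inner inner_commute
          algebra_simps)
    have "norm ((u t + u s - 2 *\<^sub>R u r) \<bullet> f r) \<le> 2 * K * (t - s) * K" if r: "r \<in> {s..t}" for r
    proof -
      have "u t + u s - 2 *\<^sub>R u r = (u t - u r) - (u r - u s)" by (simp add: scaleR_2)
      then have "norm (u t + u s - 2 *\<^sub>R u r) \<le> norm (u t - u r) + norm (u r - u s)"
        by (metis norm_triangle_ineq4)
      also have "\<dots> \<le> K * (t - r) + K * (r - s)"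
        using lip[of r t] lip[of s r] r st by (intro add_mono) auto
      also have "\<dots> \<le> 2 * K * (t - s)"
        using K0 st by (simp add: algebra_simps mult_left_mono)
      finally have "norm (u t + u s - 2 *\<^sub>R u r) * norm (f r) \<le> 2 * K * (t - s) * K"
        using K[of r] r st K0 by (intro mult_mono) auto
      then show ?thesis using Cauchy_Schwarz_ineq2[of "u t + u s - 2 *\<^sub>R u r" "f r"] by simp
    qed
    from has_integral_bound[OF _ h[folded cbox_interval] this] K0 st
    show "\<bar>?F t - ?F s\<bar> \<le> 2 * K * K * (t - s)\<^sup>2"
      by (simp add: power2_eq_square mult_ac)
  qed (rule ab)
  then have "integral {a..b} (\<lambda>s. 2 * (u s \<bullet> f s)) = (norm (u b))\<^sup>2 - (norm (u a))\<^sup>2"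
    by simp
  then show ?thesis using integrable_integral[OF int] by simp
qed

section \<open>Powers of stochastic matrices\<close>

text \<open>The recursion puts the new factor on the left: this is prepending an edge to a path, and
  averaging the entries of a column with the weights of one row.\<close>

primrec mpow :: "('p::finite \<Rightarrow> 'p \<Rightarrow> real) \<Rightarrow> nat \<Rightarrow> 'p \<Rightarrow> 'p \<Rightarrow> real" where
  "mpow A 0 = (\<lambda>i j. of_bool (i = j))"
| "mpow A (Suc n) = (\<lambda>i j. \<Sum>l\<in>UNIV. A i l * mpow A n l j)"

lemma mpow_add: "mpow A (m + n) i j = (\<Sum>l\<in>UNIV. mpow A m i l * mpow A n l j)"
proof (induction m arbitrary: i)
  case 0
  then show ?case by (simp add: of_bool_def if_distrib if_distribR cong: if_cong)
next
  case (Suc m)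
  have "mpow A (Suc m + n) i j = (\<Sum>k\<in>UNIV. \<Sum>l\<in>UNIV. A i k * (mpow A m k l * mpow A n l j))"
    by (simp add: Suc sum_distrib_left)
  also have "\<dots> = (\<Sum>l\<in>UNIV. \<Sum>k\<in>UNIV. A i k * (mpow A m k l * mpow A n l j))"
    by (rule sum.swap)
  finally show ?case by (simp add: sum_distrib_right mult.assoc)
qed

lemma mpow_Suc_right: "mpow A (Suc n) i j = (\<Sum>l\<in>UNIV. mpow A n i l * A l j)"
  using mpow_add[of A n 1 i j] by (simp add: of_bool_def if_distrib cong: if_cong)

lemma sum_mpow_0_scaleR:
  fixes f :: "'p::finite \<Rightarrow> 'a::real_vector"
  shows "(\<Sum>j\<in>UNIV. mpow A 0 i j *\<^sub>R f j) = f i"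
proof -
  have "mpow A 0 i j *\<^sub>R f j = (if i = j then f j else 0)" for j by simp
  then show ?thesis by simp
qed

lemma mpow_left_invariant:
  assumes "\<And>j. (\<Sum>i\<in>UNIV. r i * A i j) = r j"
  shows "(\<Sum>i\<in>UNIV. r i * mpow A n i j) = r j"
proof (induction n arbitrary: j)
  case 0
  then show ?case by (simp add: of_bool_def if_distrib cong: if_cong)
next
  case (Suc n)
  have "(\<Sum>i\<in>UNIV. r i * mpow A (Suc n) i j) = (\<Sum>i\<in>UNIV. \<Sum>l\<in>UNIV. r i * A i l * mpow A n l j)"
    by (simp add: sum_distrib_left mult.assoc)
  also have "\<dots> = (\<Sum>l\<in>UNIV. \<Sum>i\<in>UNIV. r i * A i l * mpow A n l j)"
    by (rule sum.swap)
  also have "\<dots> = r j" by (simp add: sum_distrib_right[symmetric] assms Suc)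
  finally show ?case .
qed

locale stochastic =
  fixes A :: "'p::finite \<Rightarrow> 'p \<Rightarrow> real"
  assumes nonneg: "A i j \<ge> 0" and row_sum: "(\<Sum>j\<in>UNIV. A i j) = 1"
begin

lemma mpow_nonneg: "mpow A n i j \<ge> 0"
  by (induction n arbitrary: i) (auto intro!: sum_nonneg mult_nonneg_nonneg nonneg)

lemma mpow_row_sum: "(\<Sum>j\<in>UNIV. mpow A n i j) = 1"
proof (induction n arbitrary: i)
  case 0
  then show ?case by simp
next
  case (Suc n)
  have "(\<Sum>j\<in>UNIV. mpow A (Suc n) i j) = (\<Sum>l\<in>UNIV. \<Sum>j\<in>UNIV. A i l * mpow A n l j)"
    by (simp, rule sum.swap)
  also have "\<dots> = 1" by (simp add: sum_distrib_left[symmetric] Suc row_sum)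
  finally show ?case .
qed

lemma mpow_stochastic: "stochastic (mpow A n)"
  by standard (simp_all add: mpow_nonneg mpow_row_sum)

lemma mpow_le_1: "mpow A n i j \<le> 1"
  using member_le_sum[of j UNIV "mpow A n i"] by (simp add: mpow_nonneg mpow_row_sum)

text \<open>Weight \<delta> falls on \<open>y k\<close> and only the remaining
  \<open>1 - \<delta>\<close> is free in \<open>{a..b}\<close>. The resulting interval depends on
  \<open>i\<close> only through the hypothesis, so rows that share \<open>k\<close> and \<delta>
  share an interval of length \<open>(1 - \<delta>) * (b - a)\<close>.\<close>

lemma average_bounds:
  assumes "\<And>j. y j \<in> {a..b}" and k: "\<delta> \<le> A i k"
  shows "(\<Sum>j\<in>UNIV. A i j * y j) \<in> {\<delta> * y k + (1 - \<delta>) * a .. \<delta> * y k + (1 - \<delta>) * b}"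
proof -
  have split: "(\<Sum>j\<in>UNIV. A i j * z j) = A i k * z k + (\<Sum>j\<in>UNIV-{k}. A i j * z j)" for z
    by (simp add: sum.remove)
  have rest: "(\<Sum>j\<in>UNIV-{k}. A i j) = 1 - A i k"
    using row_sum[of i] split[of "\<lambda>_. 1"] by simp
  have "(\<Sum>j\<in>UNIV-{k}. A i j * y j) \<le> (\<Sum>j\<in>UNIV-{k}. A i j * b)"
       "(\<Sum>j\<in>UNIV-{k}. A i j * a) \<le> (\<Sum>j\<in>UNIV-{k}. A i j * y j)"
    using assms nonneg by (auto intro!: sum_mono mult_left_mono)
  then have "(\<Sum>j\<in>UNIV. A i j * y j) \<le> A i k * y k + (1 - A i k) * b"
    "A i k * y k + (1 - A i k) * a \<le> (\<Sum>j\<in>UNIV. A i j * y j)"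
    unfolding split by (auto simp: sum_distrib_right[symmetric] rest)
  moreover have "(A i k - \<delta>) * (b - y k) \<ge> 0" "(A i k - \<delta>) * (y k - a) \<ge> 0"
    using assms(1)[of k] k by auto
  ultimately show ?thesis by (auto simp: algebra_simps)
qed

text \<open>Doeblin's contraction argument: every row of \<open>A\<close> gives weight at least
  \<delta> to the same index \<open>k\<close>, so each further factor \<open>A\<close> shrinks the
  range of a column by \<open>1 - \<delta>\<close>.\<close>

lemma mpow_column_spread:
  assumes "\<And>i. \<delta> \<le> A i k"
  shows "\<exists>a b. b - a \<le> (1 - \<delta>) ^ n \<and> (\<forall>i. mpow A n i j \<in> {a..b})"
proof (induction n)
  case 0
  show ?case by (intro exI[of _ 0] exI[of _ 1]) (auto simp: of_bool_def)
next
  case (Suc n)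
  then obtain a b where ab: "b - a \<le> (1 - \<delta>) ^ n" "\<And>i. mpow A n i j \<in> {a..b}" by blast
  let ?a = "\<delta> * mpow A n k j + (1 - \<delta>) * a" and ?b = "\<delta> * mpow A n k j + (1 - \<delta>) * b"
  have "A k k \<le> 1" using member_le_sum[of k UNIV "A k"] by (simp add: nonneg row_sum)
  then have "\<delta> \<le> 1" using assms[of k] by simp
  then have "(1 - \<delta>) * (b - a) \<le> (1 - \<delta>) * (1 - \<delta>) ^ n"
    using ab(1) by (intro mult_left_mono) auto
  then have "?b - ?a \<le> (1 - \<delta>) ^ Suc n" by (simp add: algebra_simps)
  moreover have "\<forall>i. mpow A (Suc n) i j \<in> {?a..?b}"
    using average_bounds[where y = "\<lambda>l. mpow A n l j", OF ab(2) assms] by simp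
  ultimately show ?case by blast
qed

lemma mpow_mult: "mpow (mpow A m) n = mpow A (n * m)"
  by (induction n) (simp_all add: mpow_add fun_eq_iff)

text \<open>The positive diagonal makes positivity of an entry persist for all larger powers.\<close>
lemma eventually_positive_column:
  assumes diag: "\<And>i. A i i > 0" and reach: "\<And>i. (i, k) \<in> {(i, j). A i j > 0}\<^sup>*"
  shows "\<exists>m>0. \<forall>i. mpow A m i k > 0"
proof -
  have pos_Suc: "mpow A (Suc n) i k > 0" if "A i l > 0" "mpow A n l k > 0" for n i l
  proof -
    have "0 < A i l * mpow A n l k" using that by simp
    also have "\<dots> \<le> mpow A (Suc n) i k"
      using member_le_sum[of l UNIV "\<lambda>l. A i l * mpow A n l k"] nonneg mpow_nonneg by simp
    finally show ?thesis .
  qed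
  have "\<exists>n. mpow A n i k > 0" for i
    using reach[of i]
  proof (induction rule: converse_rtrancl_induct)
    case base
    show ?case by (intro exI[of _ 0]) simp
  next
    case (step i l)
    then show ?case using pos_Suc by blast
  qed
  then obtain n where n: "\<And>i. mpow A (n i) i k > 0" by metis
  have "mpow A (n i + d) i k > 0" for i d
    by (induction d) (use n pos_Suc[OF diag] in auto)
  then have "mpow A m i k > 0" if "n i \<le> m" for i m
    using that by (metis le_add_diff_inverse)
  \<comment> \<open>One exponent beyond all the \<open>n i\<close> works for every row at once; the
    \<open>Suc\<close> makes it positive.\<close>
  then have "\<forall>i. mpow A (Suc (Max (range n))) i k > 0" by (simp add: le_SucI del: mpow.simps)
  then show ?thesis by blast
qed

text \<open>Some power \<open>mpow A m\<close> has a positive column, so the columns of its powers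
  become nearly constant. The invariance of \<open>r\<close> identifies the limit value of column
  \<open>j\<close> as \<open>r j\<close>.\<close>

lemma mpow_close_to_invariant:
  assumes diag: "\<And>i. A i i > 0" and reach: "\<And>i. (i, k) \<in> {(i, j). A i j > 0}\<^sup>*"
    and r: "\<And>j. (\<Sum>i\<in>UNIV. r i * A i j) = r j" "(\<Sum>i\<in>UNIV. r i) = 1" and "\<eta> > 0"
  shows "\<exists>n>0. \<forall>i j. \<bar>mpow A n i j - r j\<bar> \<le> \<eta>"
proof -
  obtain m where "m > 0" and m: "\<And>i. mpow A m i k > 0"
    using eventually_positive_column[OF diag reach] by blast
  define \<delta> where "\<delta> = Min (range (\<lambda>i. mpow A m i k))"
  have \<delta>: "\<delta> > 0" "\<And>i. \<delta> \<le> mpow A m i k" using m by (auto simp: \<delta>_def)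
  interpret B: stochastic "mpow A m" by (rule mpow_stochastic)
  have \<delta>1: "\<delta> \<le> 1" using \<delta>(2)[of k] mpow_le_1[of m k k] by simp
  define R where "R = (\<Sum>i\<in>UNIV. \<bar>r i\<bar>)"
  have R0: "R \<ge> 0" by (simp add: R_def sum_nonneg)
  \<comment> \<open>The signs of the \<open>r i\<close> are not assumed, so their absolute sum
    \<open>R\<close> enters the final estimate; \<open>R + 1\<close> keeps the denominator
    positive.\<close>
  have "\<exists>n. (1 - \<delta>) ^ n < \<eta> / (R + 1)"
    using \<delta> \<delta>1 R0 \<open>\<eta> > 0\<close> by (intro real_arch_pow_inv) auto
  then obtain n where n: "(1 - \<delta>) ^ n < \<eta> / (R + 1)" by blast
  let ?n = "Suc n * m"
  have small: "\<bar>mpow A ?n i j - r j\<bar> \<le> \<eta>" for i j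
  proof -
    obtain a b where ab: "b - a \<le> (1 - \<delta>) ^ Suc n" "\<And>i. mpow A ?n i j \<in> {a..b}"
      using B.mpow_column_spread[OF \<delta>(2)] unfolding mpow_mult by blast
    have "(1 - \<delta>) ^ Suc n \<le> (1 - \<delta>) ^ n" using \<delta> \<delta>1 by (intro power_decreasing) auto
    then have ba: "b - a \<le> \<eta> / (R + 1)" using ab(1) n by linarith
    \<comment> \<open>Both facts about \<open>r\<close> are used here: its entries sum to 1, and it
      is left invariant under \<open>mpow A ?n\<close>. Only differences within column
      \<open>j\<close> remain.\<close>
    have "mpow A ?n i j - r j = (\<Sum>l\<in>UNIV. r l * (mpow A ?n i j - mpow A ?n l j))"
      by (simp add: right_diff_distrib sum_subtractf mpow_left_invariant[OF r(1)] r(2) del: mpow.simps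
          flip: sum_distrib_right)
    also have "\<bar>\<dots>\<bar> \<le> (\<Sum>l\<in>UNIV. \<bar>r l * (mpow A ?n i j - mpow A ?n l j)\<bar>)" by (rule sum_abs)
    also have "\<dots> \<le> (\<Sum>l\<in>UNIV. \<bar>r l\<bar> * (\<eta> / (R + 1)))"
    proof (intro sum_mono)
      fix l
      have "\<bar>mpow A ?n i j - mpow A ?n l j\<bar> \<le> \<eta> / (R + 1)"
        using ab(2)[of i] ab(2)[of l] ba by auto
      then show "\<bar>r l * (mpow A ?n i j - mpow A ?n l j)\<bar> \<le> \<bar>r l\<bar> * (\<eta> / (R + 1))"
        unfolding abs_mult by (intro mult_left_mono) auto
    qed
    also have "\<dots> = R * (\<eta> / (R + 1))" unfolding R_def by (rule sum_distrib_right[symmetric])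
    also have "\<dots> \<le> \<eta>" using R0 \<open>\<eta> > 0\<close> by (simp add: field_simps)
    finally show ?thesis .
  qed
  then show ?thesis using \<open>m > 0\<close> by (intro exI[of _ ?n]) auto
qed

end

section \<open>Persistent excitation\<close>

lemma integrable_Qbar_quadratic:
  fixes Q :: "real \<Rightarrow> real^'n^'n"
  assumes "Q integrable_on {a..b}" and Q: "\<And>s. s \<in> {a..b} \<Longrightarrow> Q s \<in> Qbar"
    and u: "continuous_on {a..b} u"
  shows "(\<lambda>s. u s \<bullet> (Q s *v u s)) integrable_on {a..b}"
proof -
  obtain U where U: "\<And>s. s \<in> {a..b} \<Longrightarrow> norm (u s) \<le> U"
    using continuous_on_interval_bounded[OF u] by blast
  show ?thesis
  proof (rule integrable_bounded_compose2[where H = "\<lambda>R v. v \<bullet> (R *v v)", OF assms(1) u])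
    show "continuous_on UNIV (\<lambda>z :: (real^'n^'n) \<times> (real^'n). snd z \<bullet> (fst z *v snd z))"
      unfolding matrix_vector_mult_def by (intro continuous_intros)
    show "norm (u s \<bullet> (Q s *v u s)) \<le> U\<^sup>2" if "s \<in> {a..b}" for s
    proof -
      have "norm (u s \<bullet> (Q s *v u s)) \<le> (norm (u s))\<^sup>2"
        using Qbar_inner_le[OF Q[OF that]] Qbar_nonneg[OF Q[OF that]] by simp
      also have "\<dots> \<le> U\<^sup>2" using U[OF that] by (intro power_mono) auto
      finally show ?thesis .
    qed
  qed
qed

lemma bounded_linear_matrix_vector_left:
  "bounded_linear (\<lambda>R :: real^'n^'m. R *v v)"
  by (intro linear_conv_bounded_linear[THEN iffD1] linearI)
    (simp_all add: matrix_vector_mult_add_rdistrib scaleR_matrix_vector_assoc)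

lemma bounded_linear_transpose: "bounded_linear (transpose :: real^'n^'m \<Rightarrow> real^'m^'n)"
  by (intro linear_conv_bounded_linear[THEN iffD1] linearI) (simp_all add: transpose_def vec_eq_iff)

lemma sigma_min_mult_norm_le: "sigma_min W * norm v \<le> norm (W *v v)"
proof (cases "v = 0")
  case False
  have "sigma_min W \<le> norm (W *v ((1 / norm v) *\<^sub>R v))"
    unfolding sigma_min_def
    by (rule cInf_lower) (use False in \<open>auto intro!: bdd_belowI[of _ 0] exI[of _ "(1 / norm v) *\<^sub>R v"]\<close>)
  then show ?thesis using False by (simp add: matrix_vector_mult_scaleR field_simps)
qed simp

text \<open>The integral \<open>W\<close> is symmetric, positive semidefinite and of norm at most
  \<open>b - a\<close>. Hence the squared norm of \<open>W *v v\<close> is at most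
  \<open>b - a\<close> times the form of \<open>W\<close> at \<open>v\<close>, which turns the
  singular value bound into a bound on the form.\<close>

lemma sigma_min_integral_coercive:
  fixes Q :: "real \<Rightarrow> real^'n^'n"
  assumes int: "Q integrable_on {a..b}" and Q: "\<And>s. s \<in> {a..b} \<Longrightarrow> Q s \<in> Qbar"
    and "a < b" "\<epsilon> > 0" and \<epsilon>: "\<epsilon> \<le> sigma_min (integral {a..b} Q)"
  shows "\<epsilon>\<^sup>2 / (b - a) * (norm v)\<^sup>2 \<le> integral {a..b} (\<lambda>s. v \<bullet> (Q s *v v))"
proof -
  define W where "W = integral {a..b} Q"
  have Wv: "W *v v = integral {a..b} (\<lambda>s. Q s *v v)" for v
    using integral_linear[OF int bounded_linear_matrix_vector_left] by (simp add: W_def o_def)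
  have intv: "(\<lambda>s. Q s *v v) integrable_on {a..b}" for v
    using integrable_linear[OF int bounded_linear_matrix_vector_left] by (simp add: o_def)
  have vWv: "v \<bullet> (W *v v) = integral {a..b} (\<lambda>s. v \<bullet> (Q s *v v))" for v
    using integral_linear[OF intv bounded_linear_inner_right] by (simp add: Wv o_def)
  have "transpose W = integral {a..b} (transpose \<circ> Q)"
    unfolding W_def by (rule integral_linear[OF int bounded_linear_transpose, symmetric])
  also have "\<dots> = W"
    unfolding W_def by (intro Henstock_Kurzweil_Integration.integral_cong) (use Qbar_transpose Q in auto)
  finally have sym: "transpose W = W" .
  have psd: "v \<bullet> (W *v v) \<ge> 0" for v
    unfolding vWv by (intro Henstock_Kurzweil_Integration.integral_nonneg)
      (use integrable_Qbar_quadratic[OF int Q] Qbar_nonneg Q in auto)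
  have norm: "norm (W *v v) \<le> (b - a) * norm v" for v
  proof -
    have "norm (W *v v) \<le> integral {a..b} (\<lambda>s. norm v)"
      unfolding Wv by (intro Henstock_Kurzweil_Integration.integral_norm_bound_integral intv)
        (use Qbar_norm_le Q in auto)
    then show ?thesis using \<open>a < b\<close> by simp
  qed
  have "\<epsilon> * norm v \<le> sigma_min W * norm v"
    using \<epsilon> by (intro mult_right_mono) (auto simp: W_def)
  also have "\<dots> \<le> norm (W *v v)" by (rule sigma_min_mult_norm_le)
  finally have "(\<epsilon> * norm v)\<^sup>2 \<le> (norm (W *v v))\<^sup>2"
    using \<open>\<epsilon> > 0\<close> by (intro power_mono) auto
  also have "\<dots> \<le> (b - a) * (v \<bullet> (W *v v))"
    using psd_norm_image_squared_le[OF sym psd _ norm] \<open>a < b\<close> by simp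
  finally show ?thesis using \<open>a < b\<close> unfolding vWv by (simp add: field_simps)
qed

text \<open>If the dissipation \<open>D\<close> over the window is small, then the \<open>e\<^sub>i\<close> hardly move, because
  \<open>\<parallel>Qe\<parallel>\<^sup>2 \<le> e\<^sup>TQe\<close>; so \<open>D\<close> is comparable to the excitation of the frozen values \<open>e\<^sub>i(a)\<close>.\<close>
lemma excitation_window:
  fixes Q :: "real \<Rightarrow> real^'n^'n" and e :: "'p::finite \<Rightarrow> real \<Rightarrow> real^'n"
    and G :: "'p \<Rightarrow> 'p \<Rightarrow> real" and a b g \<epsilon> :: real
  assumes prim: "\<And>i t. t \<in> {a..b} \<Longrightarrow>
      ((\<lambda>s. Q s *v (\<Sum>j\<in>UNIV. G i j *\<^sub>R e j s)) has_integral (e i t - e i a)) {a..t}"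
    and int: "Q integrable_on {a..b}" and Q: "\<And>s. s \<in> {a..b} \<Longrightarrow> Q s \<in> Qbar" and ab: "a < b"
    and coer: "\<And>v. \<epsilon> * (norm v)\<^sup>2 \<le> integral {a..b} (\<lambda>s. v \<bullet> (Q s *v v))"
    and g: "\<And>i. (\<Sum>j\<in>UNIV. \<bar>G i j\<bar>) \<le> g"
  shows "\<epsilon> * (\<Sum>i\<in>UNIV. (norm (e i a))\<^sup>2) \<le>
    (2 + 2 * real CARD('p) * (b - a)\<^sup>2 * g\<^sup>2) * integral {a..b} (\<lambda>s. \<Sum>i\<in>UNIV. e i s \<bullet> (Q s *v e i s))"
proof -
  define q where "q = (\<lambda>s. \<Sum>i\<in>UNIV. e i s \<bullet> (Q s *v e i s))"
  define D where "D = integral {a..b} q"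
  define T where "T = b - a"
  have T: "T > 0" using ab by (simp add: T_def)
  have g0: "g \<ge> 0" by (rule order_trans[OF _ g]) (simp add: sum_nonneg)
  have cont: "continuous_on {a..b} (e i)" for i
    using prim by (rule continuous_on_primitive)
  have int_qi: "(\<lambda>s. e i s \<bullet> (Q s *v e i s)) integrable_on {a..b}" for i
    by (rule integrable_Qbar_quadratic[OF int Q cont])
  have int_q: "q integrable_on {a..b}"
    unfolding q_def by (intro integrable_sum int_qi) auto
  have qi_le: "0 \<le> e i s \<bullet> (Q s *v e i s)" "e i s \<bullet> (Q s *v e i s) \<le> q s" if "s \<in> {a..b}" for i s
    using Qbar_nonneg[OF Q[OF that]] member_le_sum[of i UNIV "\<lambda>i. e i s \<bullet> (Q s *v e i s)"]
    by (auto simp: q_def)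
  have q0: "q s \<ge> 0" if "s \<in> {a..b}" for s
    unfolding q_def by (intro sum_nonneg qi_le that)
  have D0: "D \<ge> 0"
    unfolding D_def using int_q q0 by (rule Henstock_Kurzweil_Integration.integral_nonneg)
  \<comment> \<open>Each \<open>norm (Q s *v e j s)\<close> is at most \<open>sqrt (q s)\<close>, so
    the dissipation density controls the velocity.\<close>
  have speed: "norm (Q s *v (\<Sum>j\<in>UNIV. G i j *\<^sub>R e j s)) \<le> g * sqrt (q s)" if s: "s \<in> {a..b}" for i s
  proof -
    have "norm (Q s *v (\<Sum>j\<in>UNIV. G i j *\<^sub>R e j s)) \<le> (\<Sum>j\<in>UNIV. norm (G i j *\<^sub>R (Q s *v e j s)))"
      unfolding matrix_vector_mult_sum_right matrix_vector_mult_scaleR by (rule norm_sum)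
    also have "\<dots> \<le> (\<Sum>j\<in>UNIV. \<bar>G i j\<bar> * sqrt (q s))"
    proof (rule sum_mono)
      fix j
      have "(norm (Q s *v e j s))\<^sup>2 \<le> q s"
        using Qbar_norm_squared_le[OF Q[OF s], of "e j s"] qi_le(2)[OF s, of j] by linarith
      then have "norm (Q s *v e j s) \<le> sqrt (q s)" by (rule real_le_rsqrt)
      then show "norm (G i j *\<^sub>R (Q s *v e j s)) \<le> \<bar>G i j\<bar> * sqrt (q s)"
        by (simp add: mult_left_mono)
    qed
    also have "\<dots> = (\<Sum>j\<in>UNIV. \<bar>G i j\<bar>) * sqrt (q s)" by (rule sum_distrib_right[symmetric])
    also have "\<dots> \<le> g * sqrt (q s)" using g q0[OF s] by (intro mult_right_mono) auto
    finally show ?thesis .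
  qed
  \<comment> \<open>The weight chosen below divides by the dissipation, and \<open>D\<close> may
    vanish. The estimate is therefore proved for every \<open>D' > D\<close>, and \<open>D'\<close>
    tends to \<open>D\<close> at the end.\<close>
  have main: "\<epsilon> * (\<Sum>i\<in>UNIV. (norm (e i a))\<^sup>2) \<le> (2 + 2 * real CARD('p) * T\<^sup>2 * g\<^sup>2) * D'"
    if D': "D < D'" for D'
  proof -
    have D'0: "D' > 0" using D0 D' by simp
    \<comment> \<open>The weight balancing both terms in \<open>2 \<surd>q \<le> l q + 1/l\<close> after integration.\<close>
    define l where "l = sqrt (T / D')"
    \<comment> \<open>The Cauchy-Schwarz bound for \<open>g\<close> times the integral of
      \<open>sqrt (q s)\<close> over the window, with \<open>D'\<close> for \<open>D\<close>; it
      limits how far any \<open>e i\<close> moves.\<close>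
    define \<delta> where "\<delta> = g * sqrt (T * D')"
    have l: "l > 0" using T D'0 by (simp add: l_def)
    have lT: "(l * D' + T / l) / 2 = sqrt (T * D')"
      using T D'0 by (simp add: l_def real_sqrt_divide real_sqrt_mult field_simps)
    have move: "norm (e i s - e i a) \<le> \<delta>" if s: "s \<in> {a..b}" for i s
    proof -
      have int_b: "(\<lambda>r. g * ((l * q r + 1 / l) / 2)) integrable_on {a..b}"
        using int_q by (intro integrable_on_mult_right integrable_on_divide integrable_add integrable_const_ivl)
      have pt: "norm (Q r *v (\<Sum>j\<in>UNIV. G i j *\<^sub>R e j r)) \<le> g * ((l * q r + 1 / l) / 2)"
        if r: "r \<in> {a..b}" for r
      proof -
        have "0 \<le> (l * sqrt (q r) - 1)\<^sup>2" by simp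
        then have "2 * l * sqrt (q r) \<le> l\<^sup>2 * q r + 1"
          using q0[OF r] by (simp add: power2_diff power_mult_distrib)
        then have "sqrt (q r) \<le> (l * q r + 1 / l) / 2"
          using l by (simp add: field_simps power2_eq_square)
        then have "g * sqrt (q r) \<le> g * ((l * q r + 1 / l) / 2)"
          using g0 by (rule mult_left_mono)
        with speed[OF r, of i] show ?thesis by linarith
      qed
      have "norm (e i s - e i a) = norm (integral {a..s} (\<lambda>s. Q s *v (\<Sum>j\<in>UNIV. G i j *\<^sub>R e j s)))"
        using integral_unique[OF prim[OF s, of i]] by simp
      also have "\<dots> \<le> integral {a..s} (\<lambda>r. g * ((l * q r + 1 / l) / 2))"
      proof (rule Henstock_Kurzweil_Integration.integral_norm_bound_integral)
        show "(\<lambda>s. Q s *v (\<Sum>j\<in>UNIV. G i j *\<^sub>R e j s)) integrable_on {a..s}"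
          using prim[OF s, of i] by (rule has_integral_integrable)
        show "(\<lambda>r. g * ((l * q r + 1 / l) / 2)) integrable_on {a..s}"
          by (rule integrable_subinterval_real[OF int_b]) (use s in auto)
      qed (use pt s in auto)
      also have "\<dots> \<le> integral {a..b} (\<lambda>r. g * ((l * q r + 1 / l) / 2))"
      proof (rule integral_subset_le)
        show "(\<lambda>r. g * ((l * q r + 1 / l) / 2)) integrable_on {a..s}"
          by (rule integrable_subinterval_real[OF int_b]) (use s in auto)
      qed (use s int_b g0 q0 l in auto)
      also have "\<dots> = g * ((l * D + T / l) / 2)"
      proof -
        have "((\<lambda>r. g * ((l * q r + 1 / l) / 2)) has_integral g * ((l * D + (b - a) *\<^sub>R (1 / l)) / 2)) {a..b}"
          using integrable_integral[OF int_q] has_integral_const_real[of "1 / l" a b] ab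
          by (intro has_integral_mult_right has_integral_divide has_integral_add) (auto simp: D_def)
        from integral_unique[OF this] show ?thesis unfolding T_def by simp
      qed
      also have "\<dots> \<le> g * ((l * D' + T / l) / 2)"
        using g0 l D' by (intro mult_left_mono) (auto intro: mult_left_mono)
      finally show ?thesis unfolding lT \<delta>_def .
    qed
    \<comment> \<open>Split \<open>e i a\<close> into \<open>e i s\<close> and the displacement
      \<open>e i a - e i s\<close>; since \<open>Q s\<close> has norm at most 1, the form at the
      displacement is at most the square of \<delta>.\<close>
    have each: "\<epsilon> * (norm (e i a))\<^sup>2 \<le> 2 * integral {a..b} (\<lambda>s. e i s \<bullet> (Q s *v e i s)) + 2 * T * \<delta>\<^sup>2" for i
    proof -
      have "\<epsilon> * (norm (e i a))\<^sup>2 \<le> integral {a..b} (\<lambda>s. e i a \<bullet> (Q s *v e i a))" by (rule coer)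
      also have "\<dots> \<le> 2 * integral {a..b} (\<lambda>s. e i s \<bullet> (Q s *v e i s)) + (b - a) *\<^sub>R (2 * \<delta>\<^sup>2)"
      proof (rule has_integral_le)
        show "((\<lambda>s. e i a \<bullet> (Q s *v e i a)) has_integral
            integral {a..b} (\<lambda>s. e i a \<bullet> (Q s *v e i a))) {a..b}"
          by (intro integrable_integral integrable_Qbar_quadratic[OF int Q]) auto
        show "((\<lambda>s. 2 * (e i s \<bullet> (Q s *v e i s)) + 2 * \<delta>\<^sup>2) has_integral
            2 * integral {a..b} (\<lambda>s. e i s \<bullet> (Q s *v e i s)) + (b - a) *\<^sub>R (2 * \<delta>\<^sup>2)) {a..b}"
          using has_integral_const_real[of "2 * \<delta>\<^sup>2" a b] ab
          by (intro has_integral_add has_integral_mult_right integrable_integral int_qi) auto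
        fix s assume s: "s \<in> {a..b}"
        have "(norm (e i a - e i s))\<^sup>2 \<le> \<delta>\<^sup>2"
          using move[OF s, of i] by (intro power_mono) (auto simp: norm_minus_commute)
        then show "e i a \<bullet> (Q s *v e i a) \<le> 2 * (e i s \<bullet> (Q s *v e i s)) + 2 * \<delta>\<^sup>2"
          using psd_add_le[OF Qbar_transpose Qbar_nonneg, OF Q[OF s] Q[OF s], of "e i s" "e i a - e i s"]
            Qbar_inner_le[OF Q[OF s], of "e i a - e i s"] by simp
      qed
      finally show ?thesis by (simp add: T_def algebra_simps)
    qed
    have "\<epsilon> * (\<Sum>i\<in>UNIV. (norm (e i a))\<^sup>2)
        \<le> (\<Sum>i\<in>UNIV. 2 * integral {a..b} (\<lambda>s. e i s \<bullet> (Q s *v e i s)) + 2 * T * \<delta>\<^sup>2)"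
      unfolding sum_distrib_left by (intro sum_mono each)
    also have "\<dots> = 2 * D + real CARD('p) * (2 * T * \<delta>\<^sup>2)"
      unfolding D_def q_def
      by (subst Henstock_Kurzweil_Integration.integral_sum) (auto simp: int_qi sum.distrib sum_distrib_left)
    also have "\<dots> \<le> 2 * D' + real CARD('p) * (2 * T * \<delta>\<^sup>2)" using D' by simp
    also have "\<dots> = (2 + 2 * real CARD('p) * T\<^sup>2 * g\<^sup>2) * D'"
      using T D'0 by (simp add: \<delta>_def power_mult_distrib) (simp add: power2_eq_square algebra_simps)
    finally show ?thesis .
  qed
  let ?C = "2 + 2 * real CARD('p) * T\<^sup>2 * g\<^sup>2"
  have C: "?C > 0" by (intro add_pos_nonneg) auto
  have "\<epsilon> * (\<Sum>i\<in>UNIV. (norm (e i a))\<^sup>2) / ?C \<le> D"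
    by (rule dense_ge) (use main C in \<open>auto simp: divide_le_eq mult.commute\<close>)
  then show ?thesis using C by (simp add: divide_le_eq mult.commute D_def q_def T_def)
qed

text \<open>Round \<open>t\<close> down to a multiple of \<open>T\<close>, iterate the contraction
  up to there and use monotonicity afterwards. The incomplete window costs the factor
  \<open>1 / \<rho>\<close>.\<close>

lemma exponential_decay:
  fixes V :: "real \<Rightarrow> real"
  assumes mono: "\<And>s t. \<lbrakk>0 \<le> s; s \<le> t\<rbrakk> \<Longrightarrow> V t \<le> V s" and V0: "V 0 \<ge> 0"
    and contr: "\<And>t. 0 \<le> t \<Longrightarrow> V (t + T) \<le> \<rho> * V t" and "0 < \<rho>" "\<rho> < 1" "T > 0" "t \<ge> 0"
  shows "V t \<le> V 0 / \<rho> * exp (ln \<rho> / T * t)"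
proof -
  have iter: "V (real n * T) \<le> \<rho> ^ n * V 0" for n
  proof (induction n)
    case (Suc n)
    have "V (real (Suc n) * T) = V (real n * T + T)" by (simp add: algebra_simps)
    also have "\<dots> \<le> \<rho> * V (real n * T)" using \<open>T > 0\<close> by (intro contr) simp
    also have "\<dots> \<le> \<rho> * (\<rho> ^ n * V 0)" using \<open>0 < \<rho>\<close> Suc by (intro mult_left_mono) auto
    finally show ?case by simp
  qed simp
  define n where "n = nat \<lfloor>t / T\<rfloor>"
  have "0 \<le> t / T" using assms by simp
  then have n: "real n \<le> t / T" "t / T - 1 \<le> real n" by (simp_all add: n_def)
  have "V t \<le> V (real n * T)"
    using n(1) \<open>T > 0\<close> by (intro mono) (auto simp: field_simps)
  also have "\<dots> \<le> \<rho> ^ n * V 0" by (rule iter)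
  also have "\<dots> \<le> \<rho> powr (t / T - 1) * V 0"
  proof (rule mult_right_mono[OF _ V0])
    have "\<rho> ^ n = \<rho> powr real n" using \<open>0 < \<rho>\<close> by (simp add: powr_realpow)
    also have "\<dots> \<le> \<rho> powr (t / T - 1)" using n(2) \<open>0 < \<rho>\<close> \<open>\<rho> < 1\<close> by (intro powr_mono') auto
    finally show "\<rho> ^ n \<le> \<rho> powr (t / T - 1)" .
  qed
  also have "\<dots> = V 0 / \<rho> * exp (ln \<rho> / T * t)"
    using \<open>0 < \<rho>\<close> by (simp add: powr_diff) (simp add: powr_def mult.commute)
  finally show ?thesis .
qed

section \<open>The Lyapunov function\<close>

text \<open>A row vector times one column of \<open>I + h G\<close>; it serves both for the powers
  of \<open>A\<close> and for the invariance of \<open>r\<close>.\<close>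

lemma sum_mult_of_bool_add:
  fixes f g :: "'p::finite \<Rightarrow> real"
  shows "(\<Sum>l\<in>UNIV. f l * (of_bool (l = j) + h * g l)) = f j + h * (\<Sum>l\<in>UNIV. f l * g l)"
proof -
  have "f l * (of_bool (l = j) + h * g l) = (if l = j then f l else 0) + h * (f l * g l)" for l
    by (simp add: algebra_simps)
  then show ?thesis by (simp add: sum.distrib sum_distrib_left)
qed

text \<open>Along solutions, \<open>y\<^sub>n = A\<^sup>n e\<close> satisfies \<open>h y\<^sub>n' = Q (y\<^sub>n\<^sub>+\<^sub>1 - y\<^sub>n)\<close>, so
  \<open>h (\<parallel>y\<^sub>n\<parallel>\<^sup>2)' \<le> y\<^sub>n\<^sub>+\<^sub>1\<^sup>T Q y\<^sub>n\<^sub>+\<^sub>1 - y\<^sub>n\<^sup>T Q y\<^sub>n\<close>, which telescopes in \<open>n\<close>; the remaining term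
  at \<open>n = N\<close> is small because \<open>A\<^sup>N\<close> is close to \<open>1 r\<^sup>T\<close> and \<open>r\<^sup>T e = 0\<close>.\<close>
lemma lyapunov_dissipation:
  fixes Q :: "real \<Rightarrow> real^'n^'n" and e :: "'p::finite \<Rightarrow> real \<Rightarrow> real^'n"
    and A G :: "'p \<Rightarrow> 'p \<Rightarrow> real" and r :: "'p \<Rightarrow> real" and a b h :: real
  defines "y \<equiv> \<lambda>n i t. \<Sum>j\<in>UNIV. mpow A n i j *\<^sub>R e j t"
  assumes prim: "\<And>i t. t \<in> {a..b} \<Longrightarrow>
      ((\<lambda>s. Q s *v (\<Sum>j\<in>UNIV. G i j *\<^sub>R e j s)) has_integral (e i t - e i a)) {a..t}"
    and int: "Q integrable_on {a..b}" and Q: "\<And>s. s \<in> {a..b} \<Longrightarrow> Q s \<in> Qbar" and ab: "a \<le> b"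
    and h: "h > 0" and A: "\<And>i j. A i j = of_bool (i = j) + h * G i j"
    and close: "\<And>i j. \<bar>mpow A N i j - r j\<bar> \<le> 1 / (2 * CARD('p))"
    and r: "\<And>s. s \<in> {a..b} \<Longrightarrow> (\<Sum>j\<in>UNIV. r j *\<^sub>R e j s) = 0"
  shows "(\<Sum>n<N. \<Sum>i\<in>UNIV. (norm (y n i b))\<^sup>2)
      + 1 / (2 * h) * integral {a..b} (\<lambda>s. \<Sum>i\<in>UNIV. e i s \<bullet> (Q s *v e i s))
    \<le> (\<Sum>n<N. \<Sum>i\<in>UNIV. (norm (y n i a))\<^sup>2)"
proof -
  define q where "q = (\<lambda>n s. \<Sum>i\<in>UNIV. y n i s \<bullet> (Q s *v y n i s))"
  have y0: "y 0 i = e i" for i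
    by (simp add: y_def fun_eq_iff sum_mpow_0_scaleR del: mpow.simps)
  \<comment> \<open>Since \<open>h G = A - I\<close>, multiplying \<open>A\<^sup>n\<close> by
    \<open>G\<close> gives a difference of consecutive powers.\<close>
  have AG: "(\<Sum>j\<in>UNIV. mpow A n i j * G j l) = (mpow A (Suc n) i l - mpow A n i l) / h" for n i l
    using h unfolding mpow_Suc_right by (subst A) (simp add: sum_mult_of_bool_add)
  have prim_y: "((\<lambda>s. Q s *v ((1/h) *\<^sub>R (y (Suc n) i s - y n i s))) has_integral (y n i t - y n i a)) {a..t}"
    if t: "t \<in> {a..b}" for n i t
  proof -
    have "((\<lambda>s. \<Sum>j\<in>UNIV. mpow A n i j *\<^sub>R (Q s *v (\<Sum>l\<in>UNIV. G j l *\<^sub>R e l s))) has_integral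
        (\<Sum>j\<in>UNIV. mpow A n i j *\<^sub>R (e j t - e j a))) {a..t}"
      by (intro has_integral_sum has_integral_scaleR_left has_integral_cmul prim t) auto
    moreover have "(\<Sum>j\<in>UNIV. mpow A n i j *\<^sub>R (e j t - e j a)) = y n i t - y n i a"
      by (simp add: y_def scaleR_diff_right sum_subtractf)
    moreover have "(\<Sum>j\<in>UNIV. mpow A n i j *\<^sub>R (Q s *v (\<Sum>l\<in>UNIV. G j l *\<^sub>R e l s)))
        = Q s *v ((1/h) *\<^sub>R (y (Suc n) i s - y n i s))" for s
    proof -
      have "(\<Sum>j\<in>UNIV. mpow A n i j *\<^sub>R (Q s *v (\<Sum>l\<in>UNIV. G j l *\<^sub>R e l s)))
          = Q s *v (\<Sum>j\<in>UNIV. \<Sum>l\<in>UNIV. (mpow A n i j * G j l) *\<^sub>R e l s)"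
        by (simp add: matrix_vector_mult_sum_right matrix_vector_mult_scaleR scaleR_sum_right)
      also have "(\<Sum>j\<in>UNIV. \<Sum>l\<in>UNIV. (mpow A n i j * G j l) *\<^sub>R e l s)
          = (\<Sum>l\<in>UNIV. (\<Sum>j\<in>UNIV. mpow A n i j * G j l) *\<^sub>R e l s)"
        by (subst sum.swap) (simp add: scaleR_sum_left)
      also have "\<dots> = (1/h) *\<^sub>R (y (Suc n) i s - y n i s)"
        unfolding AG y_def
        by (simp add: scaleR_sum_right scaleR_diff_right scaleR_diff_left diff_divide_distrib
            sum_subtractf del: mpow.simps)
      finally show ?thesis .
    qed
    ultimately show ?thesis by simp
  qed
  have cont: "continuous_on {a..b} (y n i)" for n i
    using prim_y by (rule continuous_on_primitive)
  have energy: "((\<lambda>s. 2 * (y n i s \<bullet> (Q s *v ((1/h) *\<^sub>R (y (Suc n) i s - y n i s))))) has_integral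
      ((norm (y n i b))\<^sup>2 - (norm (y n i a))\<^sup>2)) {a..b}" for n i
  proof -
    have "continuous_on {a..b} (\<lambda>s. (1/h) *\<^sub>R (y (Suc n) i s - y n i s))"
      by (intro continuous_intros cont)
    then obtain K where K: "\<And>s. s \<in> {a..b} \<Longrightarrow> norm ((1/h) *\<^sub>R (y (Suc n) i s - y n i s)) \<le> K"
      using continuous_on_interval_bounded by blast
    show ?thesis
      by (rule has_integral_norm_squared[OF prim_y _ ab])
        (use K order_trans[OF Qbar_norm_le[OF Q]] in blast)+
  qed
  \<comment> \<open>Because the \<open>r\<close>-weighted sum of the errors vanishes, the weights of
    \<open>y N i\<close> may be reduced by \<open>r j\<close> to size at most
    \<open>1 / (2 * CARD('p))\<close>. With the factor \<open>CARD('p)\<close> from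
    \<open>psd_sum_le\<close> and the sum over \<open>CARD('p)\<close> rows this yields
    \<open>q 0 s / 4\<close>, which is relaxed to one half.\<close>
  have qN: "q N s \<le> q 0 s / 2" if s: "s \<in> {a..b}" for s
  proof -
    note psd = Qbar_transpose[OF Q[OF s]] Qbar_nonneg[OF Q[OF s]]
    let ?p = "real CARD('p)"
    have p: "?p > 0" by simp
    have each: "y N i s \<bullet> (Q s *v y N i s) \<le> q 0 s / (4 * ?p)" for i
    proof -
      let ?c = "\<lambda>j. mpow A N i j - r j"
      have "y N i s = (\<Sum>j\<in>UNIV. ?c j *\<^sub>R e j s)"
        using r[OF s] by (simp add: y_def scaleR_diff_left sum_subtractf)
      then have "y N i s \<bullet> (Q s *v y N i s)
          \<le> ?p * (\<Sum>j\<in>UNIV. (?c j *\<^sub>R e j s) \<bullet> (Q s *v (?c j *\<^sub>R e j s)))"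
        using psd_sum_le[OF psd, of "\<lambda>j. ?c j *\<^sub>R e j s" UNIV] by simp
      also have "\<dots> \<le> ?p * (\<Sum>j\<in>UNIV. (1 / (2 * ?p))\<^sup>2 * (e j s \<bullet> (Q s *v e j s)))"
      proof (intro mult_left_mono sum_mono)
        fix j
        have "(?c j)\<^sup>2 \<le> (1 / (2 * ?p))\<^sup>2"
          using close[of i j] by (intro abs_le_square_iff[THEN iffD1]) simp
        then have "(?c j)\<^sup>2 * (e j s \<bullet> (Q s *v e j s)) \<le> (1 / (2 * ?p))\<^sup>2 * (e j s \<bullet> (Q s *v e j s))"
          using psd(2) by (rule mult_right_mono)
        then show "(?c j *\<^sub>R e j s) \<bullet> (Q s *v (?c j *\<^sub>R e j s))
            \<le> (1 / (2 * ?p))\<^sup>2 * (e j s \<bullet> (Q s *v e j s))"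
          by (simp add: matrix_vector_mult_scaleR power2_eq_square mult.assoc)
      qed simp
      also have "\<dots> = q 0 s / (4 * ?p)"
        unfolding sum_distrib_left[symmetric] q_def y0 by (simp add: power2_eq_square)
      finally show ?thesis .
    qed
    have "q N s = (\<Sum>i\<in>UNIV. y N i s \<bullet> (Q s *v y N i s))" by (simp only: q_def)
    also have "\<dots> \<le> (\<Sum>i\<in>(UNIV::'p set). q 0 s / (4 * ?p))" by (rule sum_mono[OF each])
    also have "\<dots> = q 0 s / 4" using p by simp
    also have "\<dots> \<le> q 0 s / 2"
      using psd(2) by (simp add: q_def sum_nonneg)
    finally show ?thesis .
  qed
  have rate: "(\<Sum>n<N. \<Sum>i\<in>UNIV. 2 * (y n i s \<bullet> (Q s *v ((1/h) *\<^sub>R (y (Suc n) i s - y n i s)))))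
      \<le> - (1 / (2 * h)) * q 0 s" if s: "s \<in> {a..b}" for s
  proof -
    note psd = Qbar_transpose[OF Q[OF s]] Qbar_nonneg[OF Q[OF s]]
    have "(\<Sum>n<N. \<Sum>i\<in>UNIV. 2 * (y n i s \<bullet> (Q s *v ((1/h) *\<^sub>R (y (Suc n) i s - y n i s)))))
      \<le> (\<Sum>n<N. \<Sum>i\<in>UNIV. (y (Suc n) i s \<bullet> (Q s *v y (Suc n) i s) - y n i s \<bullet> (Q s *v y n i s)) / h)"
    proof (intro sum_mono)
      fix n i
      have "2 * (y n i s \<bullet> (Q s *v (y (Suc n) i s - y n i s)))
          \<le> y (Suc n) i s \<bullet> (Q s *v y (Suc n) i s) - y n i s \<bullet> (Q s *v y n i s)"
        using psd_two_inner_le[OF psd, of "y n i s" "y (Suc n) i s"]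
        by (simp add: matrix_vector_mult_diff_distrib inner_diff_right)
      then show "2 * (y n i s \<bullet> (Q s *v ((1/h) *\<^sub>R (y (Suc n) i s - y n i s))))
          \<le> (y (Suc n) i s \<bullet> (Q s *v y (Suc n) i s) - y n i s \<bullet> (Q s *v y n i s)) / h"
        using h by (simp add: matrix_vector_mult_scaleR divide_right_mono)
    qed
    also have "\<dots> = (\<Sum>n<N. q (Suc n) s - q n s) / h"
      by (simp add: q_def sum_divide_distrib sum_subtractf diff_divide_distrib)
    also have "\<dots> = (q N s - q 0 s) / h" by (subst sum_lessThan_telescope) (rule refl)
    also have "\<dots> \<le> - (q 0 s / 2) / h"
      using qN[OF s] h by (intro divide_right_mono) auto
    finally show ?thesis by simp
  qed
  have "(\<Sum>n<N. \<Sum>i\<in>UNIV. (norm (y n i b))\<^sup>2 - (norm (y n i a))\<^sup>2) \<le> - (1 / (2 * h)) * integral {a..b} (q 0)"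
  proof (rule has_integral_le[OF _ _ rate])
    show "((\<lambda>s. \<Sum>n<N. \<Sum>i\<in>UNIV. 2 * (y n i s \<bullet> (Q s *v ((1/h) *\<^sub>R (y (Suc n) i s - y n i s)))))
        has_integral (\<Sum>n<N. \<Sum>i\<in>UNIV. (norm (y n i b))\<^sup>2 - (norm (y n i a))\<^sup>2)) {a..b}"
      by (intro has_integral_sum energy) auto
    have "q 0 integrable_on {a..b}"
      unfolding q_def by (intro integrable_sum integrable_Qbar_quadratic[OF int Q cont]) auto
    then show "((\<lambda>s. - (1 / (2 * h)) * q 0 s) has_integral - (1 / (2 * h)) * integral {a..b} (q 0)) {a..b}"
      by (intro has_integral_mult_right integrable_integral)
  qed
  then show ?thesis by (simp add: sum_subtractf q_def y0)
qed

section \<open>Synchronization\<close>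

lemma ct_interconnection_row_sum:
  assumes "ct_interconnection G"
  shows "(\<Sum>j\<in>UNIV. G $ i $ j) = 0"
  using assms by (simp add: ct_interconnection_def sum.remove[of UNIV i])

text \<open>Rows of \<open>G\<close> sum to zero, so \<open>x $ i\<close> can be exchanged for any
  common vector \<open>c\<close>; taking the synchronization value for \<open>c\<close> gives the
  equation for the errors.\<close>

lemma coupling_eq:
  fixes G :: "real^'p^'p" and x :: "real^'n^'p"
  assumes "ct_interconnection G"
  shows "(\<Sum>j\<in>UNIV-{i}. G$i$j *\<^sub>R (x $ j - x $ i)) = (\<Sum>j\<in>UNIV. G$i$j *\<^sub>R (x $ j - c))"
proof -
  have "(\<Sum>j\<in>UNIV-{i}. G$i$j *\<^sub>R (x $ j - x $ i)) = (\<Sum>j\<in>UNIV. G$i$j *\<^sub>R (x $ j - x $ i))"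
    by (simp add: sum.remove[of UNIV i])
  also have "\<dots> = (\<Sum>j\<in>UNIV. G$i$j *\<^sub>R (x $ j - c)) + (\<Sum>j\<in>UNIV. G$i$j) *\<^sub>R (c - x $ i)"
    unfolding scaleR_sum_left sum.distrib[symmetric] by (simp add: algebra_simps)
  finally show ?thesis by (simp add: ct_interconnection_row_sum[OF assms])
qed

text \<open>Solutions are taken in integrated form: \<open>Q\<close> may be discontinuous, so the
  trajectories need not be differentiable at every time.\<close>

theorem theorem5:
  fixes G :: "real^'p^'p" and Q :: "real \<Rightarrow> real^'n^'n"
    and x :: "real \<Rightarrow> real^'n^'p" and r :: "real^'p"
  assumes "ct_interconnection G" and "graph_connected G"
    and "\<forall>t\<ge>0. Q t \<in> Qbar"
    and "riemann_integrable_halfline Q"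
    and "persistently_exciting Q"
    and "\<forall>t\<ge>0. \<forall>i. ((\<lambda>s. Q s *v (\<Sum>j\<in>UNIV-{i}. G$i$j *\<^sub>R (x s $ j - x s $ i)))
                         has_integral (x t $ i - x 0 $ i)) {0..t}"
    and "\<forall>j. (\<Sum>i\<in>UNIV. r$i * G$i$j) = 0" and "(\<Sum>i\<in>UNIV. r$i) = 1"
  shows "\<exists>c \<alpha>. c > 0 \<and> \<alpha> > 0 \<and>
           (\<forall>t\<ge>0. \<forall>i. norm (x t $ i - (\<Sum>j\<in>UNIV. r$j *\<^sub>R x 0 $ j)) \<le> c * exp (- \<alpha> * t))"
proof -

  \<comment> \<open>Error coordinates and their conserved weighted mean\<close>
  define xbar where "xbar = (\<Sum>j\<in>UNIV. r$j *\<^sub>R x 0 $ j)"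
  define e where "e = (\<lambda>i t. x t $ i - xbar)"
  have int: "Q integrable_on {a..b}" if "0 \<le> a" "a \<le> b" for a b
    using assms(4) that riemann_integrable_on_imp_integrable_on
    unfolding riemann_integrable_halfline_def by blast
  have Q: "Q s \<in> Qbar" if "0 \<le> s" for s using assms(3) that by blast
  have prim0: "((\<lambda>s. Q s *v (\<Sum>j\<in>UNIV. G$i$j *\<^sub>R e j s)) has_integral (e i t - e i 0)) {0..t}"
    if "0 \<le> t" for i t
    using assms(6)[rule_format, OF that, of i]
    unfolding coupling_eq[OF assms(1), of _ _ xbar] by (simp add: e_def)
  have prim: "((\<lambda>s. Q s *v (\<Sum>j\<in>UNIV. G$i$j *\<^sub>R e j s)) has_integral (e i t - e i a)) {a..t}"
    if "0 \<le> a" "t \<in> {a..b}" for i a t b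
    by (rule has_integral_primitive_subinterval[where a = 0 and b = t]) (use prim0 that in auto)
  \<comment> \<open>The left null vector \<open>r\<close> makes the weighted sum of the velocities
    vanish, and the sum is zero at time 0 by the choice of \<open>xbar\<close> and the normalization
    of \<open>r\<close>.\<close>
  have mean: "(\<Sum>i\<in>UNIV. r$i *\<^sub>R e i t) = 0" if "0 \<le> t" for t
  proof -
    have e0: "(\<Sum>i\<in>UNIV. r$i *\<^sub>R e i 0) = 0"
      by (simp add: e_def scaleR_diff_right sum_subtractf assms(8) flip: xbar_def scaleR_sum_left)
    have "((\<lambda>s. \<Sum>i\<in>UNIV. r$i *\<^sub>R (Q s *v (\<Sum>j\<in>UNIV. G$i$j *\<^sub>R e j s))) has_integral
        (\<Sum>i\<in>UNIV. r$i *\<^sub>R (e i t - e i 0))) {0..t}"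
      by (intro has_integral_sum has_integral_cmul prim0 that) auto
    moreover have "(\<Sum>i\<in>UNIV. r$i *\<^sub>R (Q s *v (\<Sum>j\<in>UNIV. G$i$j *\<^sub>R e j s))) = 0" for s
    proof -
      have "(\<Sum>i\<in>UNIV. r$i *\<^sub>R (Q s *v (\<Sum>j\<in>UNIV. G$i$j *\<^sub>R e j s)))
          = Q s *v (\<Sum>i\<in>UNIV. \<Sum>j\<in>UNIV. (r$i * G$i$j) *\<^sub>R e j s)"
        by (simp add: matrix_vector_mult_sum_right matrix_vector_mult_scaleR scaleR_sum_right)
      also have "(\<Sum>i\<in>UNIV. \<Sum>j\<in>UNIV. (r$i * G$i$j) *\<^sub>R e j s) = 0"
        by (subst sum.swap) (simp add: assms(7) flip: scaleR_sum_left)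
      finally show ?thesis by simp
    qed
    ultimately have "(\<Sum>i\<in>UNIV. r$i *\<^sub>R (e i t - e i 0)) = 0" by (simp add: has_integral_0_eq)
    then show ?thesis using e0 by (simp add: scaleR_diff_right sum_subtractf)
  qed

  \<comment> \<open>A stochastic matrix from the interconnection\<close>
  define h where "h = 1 / (1 + (\<Sum>i\<in>UNIV. \<bar>G$i$i\<bar>))"
  define A where "A = (\<lambda>i j. of_bool (i = j) + h * G$i$j)"
  have h: "h > 0" by (simp add: h_def add_pos_nonneg sum_nonneg)
  \<comment> \<open>The step \<open>h\<close> is the reciprocal of a number exceeding every diagonal
    entry of \<open>G\<close> in absolute value.\<close>
  have diag: "A i i > 0" for i
  proof -
    have "\<bar>G$i$i\<bar> < 1 + (\<Sum>i\<in>UNIV. \<bar>G$i$i\<bar>)"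
      using member_le_sum[of i UNIV "\<lambda>i. \<bar>G$i$i\<bar>"] by simp
    then have "h * \<bar>G$i$i\<bar> < 1"
      using le_less_trans[OF abs_ge_zero] by (fastforce simp: h_def divide_less_eq_1)
    then have "h * - G$i$i < 1" using h by (smt (verit) mult_left_mono)
    then show ?thesis by (simp add: A_def)
  qed
  have off: "A i j \<ge> 0" if "i \<noteq> j" for i j
    using assms(1) h that by (simp add: A_def ct_interconnection_def)
  interpret stochastic A
  proof
    show "A i j \<ge> 0" for i j using diag[of i] off[of i j] by (cases "i = j") auto
    show "(\<Sum>j\<in>UNIV. A i j) = 1" for i
      using ct_interconnection_row_sum[OF assms(1), of i]
      by (simp add: A_def sum.distrib flip: sum_distrib_left)
  qed
  from assms(2) obtain k where k: "\<And>i. (i, k) \<in> (graph_edges G)\<^sup>*"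
    unfolding graph_connected_def by blast
  have "graph_edges G \<subseteq> {(i, j). A i j > 0}"
    using h by (auto simp: graph_edges_def A_def intro: add_nonneg_pos)
  then have reach: "(i, k) \<in> {(i, j). A i j > 0}\<^sup>*" for i
    using k rtrancl_mono by blast
  have rA: "(\<Sum>i\<in>UNIV. r$i * A i j) = r$j" for j
  proof -
    have "(\<Sum>i\<in>UNIV. r$i * A i j) = r$j + h * (\<Sum>i\<in>UNIV. r$i * G$i$j)"
      unfolding A_def by (rule sum_mult_of_bool_add)
    then show ?thesis by (simp add: assms(7))
  qed
  \<comment> \<open>The tolerance is the one required by \<open>lyapunov_dissipation\<close>;
    \<open>N > 0\<close> ensures that \<open>V\<close> below contains the term \<open>n = 0\<close>,
    which is \<open>E\<close>.\<close>
  obtain N where "N > 0" and close: "\<And>i j. \<bar>mpow A N i j - r$j\<bar> \<le> 1 / (2 * CARD('p))"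
    using mpow_close_to_invariant[OF diag reach rA assms(8), of "1 / (2 * CARD('p))"] by auto

  \<comment> \<open>Lyapunov function, squared error and dissipation\<close>
  define V where "V = (\<lambda>t. \<Sum>n<N. \<Sum>i\<in>UNIV. (norm (\<Sum>j\<in>UNIV. mpow A n i j *\<^sub>R e j t))\<^sup>2)"
  define E where "E = (\<lambda>t. \<Sum>i\<in>UNIV. (norm (e i t))\<^sup>2)"
  define D where "D = (\<lambda>a b. integral {a..b} (\<lambda>s. \<Sum>i\<in>UNIV. e i s \<bullet> (Q s *v e i s)))"
  have diss: "V b + 1 / (2 * h) * D a b \<le> V a" if "0 \<le> a" "a \<le> b" for a b
    unfolding V_def D_def
    by (rule lyapunov_dissipation[where G = "\<lambda>i j. G$i$j" and r = "\<lambda>j. r$j"])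
      (use that prim[OF that(1)] int Q h close mean in \<open>auto simp: A_def\<close>)
  have D0: "D a b \<ge> 0" if "0 \<le> a" "a \<le> b" for a b
    unfolding D_def
  proof (rule Henstock_Kurzweil_Integration.integral_nonneg)
    show "(\<lambda>s. \<Sum>i\<in>UNIV. e i s \<bullet> (Q s *v e i s)) integrable_on {a..b}"
      by (intro integrable_sum integrable_Qbar_quadratic int that Q
          continuous_on_primitive[OF prim[OF that(1)]]) (use that in auto)
  qed (use that in \<open>auto intro!: sum_nonneg Qbar_nonneg Q\<close>)
  have E_le_V: "E t \<le> V t" for t
  proof -
    have "E t = (\<Sum>i\<in>UNIV. (norm (\<Sum>j\<in>UNIV. mpow A 0 i j *\<^sub>R e j t))\<^sup>2)"
      by (simp only: E_def sum_mpow_0_scaleR)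
    also have "\<dots> \<le> V t"
      unfolding V_def using \<open>N > 0\<close>
      by (intro member_le_sum[of 0 "{..<N}" "\<lambda>n. \<Sum>i\<in>UNIV. (norm (\<Sum>j\<in>UNIV. mpow A n i j *\<^sub>R e j t))\<^sup>2"])
        (auto intro!: sum_nonneg)
    finally show ?thesis .
  qed
  let ?p = "real CARD('p)"
  \<comment> \<open>There are \<open>N\<close> powers and \<open>CARD('p)\<close> rows, and each
    squared row norm is at most \<open>CARD('p)\<close> times \<open>E t\<close> by Cauchy-Schwarz,
    as all weights lie between 0 and 1.\<close>
  define M where "M = real N * (?p * ?p)"
  have M: "M > 0" using \<open>N > 0\<close> by (simp add: M_def)
  have V_le_E: "V t \<le> M * E t" for t
  proof -
    have each: "(norm (\<Sum>j\<in>UNIV. mpow A n i j *\<^sub>R e j t))\<^sup>2 \<le> ?p * E t" for n i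
    proof -
      have "norm (\<Sum>j\<in>UNIV. mpow A n i j *\<^sub>R e j t) \<le> (\<Sum>j\<in>UNIV. norm (e j t))"
        using mpow_nonneg mpow_le_1
        by (intro order_trans[OF norm_sum] sum_mono) (simp add: mult_left_le_one_le)
      then have "(norm (\<Sum>j\<in>UNIV. mpow A n i j *\<^sub>R e j t))\<^sup>2 \<le> (\<Sum>j\<in>UNIV. norm (e j t))\<^sup>2"
        by (intro power_mono) auto
      also have "\<dots> \<le> ?p * E t"
        unfolding E_def using sum_squared_le_sum_of_squares[of "\<lambda>j. norm (e j t)" UNIV]
        by (simp add: mult.commute)
      finally show ?thesis .
    qed
    have "V t \<le> (\<Sum>n<N. \<Sum>i\<in>(UNIV::'p set). ?p * E t)"
      unfolding V_def by (intro sum_mono each)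
    then show ?thesis by (simp add: M_def mult.assoc)
  qed

  \<comment> \<open>Contraction over one excitation window\<close>
  obtain \<epsilon> T where "\<epsilon> > 0" "T > 0" and PE: "\<And>t. 0 \<le> t \<Longrightarrow> \<epsilon> \<le> sigma_min (integral {t..t+T} Q)"
    using assms(5) unfolding persistently_exciting_def by blast
  define g where "g = (\<Sum>i\<in>UNIV. \<Sum>j\<in>UNIV. \<bar>G$i$j\<bar>)"
  define L where "L = 2 + 2 * ?p * T\<^sup>2 * g\<^sup>2"
  have L: "L > 0" unfolding L_def by (intro add_pos_nonneg) auto
  have window: "\<epsilon>\<^sup>2 / T * E t \<le> L * D t (t + T)" if "0 \<le> t" for t
  proof -
    have "\<epsilon>\<^sup>2 / T * E t \<le> (2 + 2 * ?p * (t + T - t)\<^sup>2 * g\<^sup>2) * D t (t + T)"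
      unfolding E_def D_def
    proof (rule excitation_window[where G = "\<lambda>i j. G$i$j"])
      show "\<epsilon>\<^sup>2 / T * (norm v)\<^sup>2 \<le> integral {t..t+T} (\<lambda>s. v \<bullet> (Q s *v v))" for v
        using sigma_min_integral_coercive[of Q t "t + T" \<epsilon> v] int Q PE \<open>\<epsilon> > 0\<close> \<open>T > 0\<close> that by auto
      show "(\<Sum>j\<in>UNIV. \<bar>G$i$j\<bar>) \<le> g" for i
        unfolding g_def by (rule member_le_sum) (auto intro: sum_nonneg)
    qed (use that prim[OF that] int Q \<open>T > 0\<close> in auto)
    then show ?thesis by (simp add: L_def)
  qed
  \<comment> \<open>The second argument chains \<open>V \<le> M * E\<close>, the window bound of
    \<open>E\<close> by the dissipation, and the drop \<open>1 / (2 * h) * D\<close> of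
    \<open>V\<close>. The cap 1/2 keeps \<open>1 - \<theta>\<close> positive, as its logarithm
    requires.\<close>
  define \<theta> where "\<theta> = min (1/2) (1 / (2 * h) * (\<epsilon>\<^sup>2 / T / L) / M)"
  have \<theta>: "0 < \<theta>" "\<theta> \<le> 1/2" using h L M \<open>\<epsilon> > 0\<close> \<open>T > 0\<close> by (auto simp: \<theta>_def)
  have V0: "V t \<ge> 0" for t by (simp add: V_def sum_nonneg)
  have contr: "V (t + T) \<le> (1 - \<theta>) * V t" if "0 \<le> t" for t
  proof -
    have "\<theta> * V t \<le> 1 / (2 * h) * (\<epsilon>\<^sup>2 / T / L) / M * V t"
      using V0 by (intro mult_right_mono) (auto simp: \<theta>_def)
    also have "\<dots> \<le> 1 / (2 * h) * (\<epsilon>\<^sup>2 / T / L) / M * (M * E t)"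
      using h L M \<open>\<epsilon> > 0\<close> \<open>T > 0\<close> V_le_E by (intro mult_left_mono) auto
    also have "\<dots> = 1 / (2 * h) * ((\<epsilon>\<^sup>2 / T * E t) / L)"
      using M by simp
    also have "\<dots> \<le> 1 / (2 * h) * D t (t + T)"
    proof (rule mult_left_mono)
      show "\<epsilon>\<^sup>2 / T * E t / L \<le> D t (t + T)"
        unfolding pos_divide_le_eq[OF L] using window[OF that] by (simp only: mult.commute[of L])
    qed (use h in simp)
    finally show ?thesis using diss[of t "t + T"] that \<open>T > 0\<close> by (simp add: algebra_simps)
  qed
  have mono: "V t \<le> V s" if "0 \<le> s" "s \<le> t" for s t
  proof -
    have "0 \<le> 1 / (2 * h) * D s t" using D0[OF that] h by simp
    then show ?thesis using diss[OF that] by linarith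
  qed
  \<comment> \<open>The rate is halved because \<open>V\<close> bounds the square of the error norm.
    In \<open>c\<close> the summand 1 keeps the constant positive when
    \<open>V 0 = 0\<close>.\<close>
  define \<alpha> where "\<alpha> = - ln (1 - \<theta>) / T / 2"
  define c where "c = sqrt (V 0 / (1 - \<theta>)) + 1"
  have "norm (e i t) \<le> c * exp (- \<alpha> * t)" if "0 \<le> t" for i t
  proof -
    have "(norm (e i t))\<^sup>2 \<le> E t"
      unfolding E_def by (rule member_le_sum) auto
    also have "\<dots> \<le> V t" by (rule E_le_V)
    also have "\<dots> \<le> V 0 / (1 - \<theta>) * exp (ln (1 - \<theta>) / T * t)"
      by (rule exponential_decay[where V = V, OF mono V0 contr]) (use \<theta> \<open>T > 0\<close> that in auto)
    also have "\<dots> = V 0 / (1 - \<theta>) * (exp (- \<alpha> * t))\<^sup>2"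
      by (simp add: \<alpha>_def flip: exp_double)
    finally have "norm (e i t) \<le> sqrt (V 0 / (1 - \<theta>) * (exp (- \<alpha> * t))\<^sup>2)"
      by (rule real_le_rsqrt)
    also have "\<dots> = sqrt (V 0 / (1 - \<theta>)) * exp (- \<alpha> * t)"
      by (simp only: real_sqrt_mult real_sqrt_abs abs_exp_cancel)
    also have "\<dots> \<le> c * exp (- \<alpha> * t)" by (simp add: c_def)
    finally show ?thesis .
  qed
  moreover have "\<alpha> > 0" using \<theta> \<open>T > 0\<close> by (simp add: \<alpha>_def divide_neg_pos)
  moreover have "c > 0" using V0[of 0] \<theta> by (auto simp: c_def intro!: add_nonneg_pos)
  ultimately show ?thesis unfolding e_def xbar_def by blast
qed

end
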